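(* If $G$ is a well-covered bipartite graph, then $\operatorname{indmatch} G=\operatorname{cochord} G$.
   Context: All graphs are finite and simple. A graph is well-covered if every maximal independent set has the same cardinality. An induced matching is a set of pairwise disjoint edges forming an induced subgraph; $\operatorname{indmatch} G$ is the maximum number of edges in an induced matching. A graph is co-chordal if its complement is chordal (every induced cycle has length 3); $\operatorname{cochord} G$ is the minimum number of co-chordal subgraphs of $G$ whose edge sets together cover $E(G)$. *)

theory Defs
  imports "Graph_Theory.Graph_Theory"
begin

text \<open>
  A finite simple graph is a \<^locale>\<open>pair_graph\<close>: a finite, loopless, symmetric set of pairs. Each
  undirected edge is represented by two opposite arcs, so edges are counted as two-element sets.
\<close>

definition uedges :: "'a pair_pre_digraph \<Rightarrow> 'a set set" where
  "uedges G = {{u, v} |u v. (u, v) \<in> parcs G}"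

definition independent_set :: "'a pair_pre_digraph \<Rightarrow> 'a set \<Rightarrow> bool" where
  "independent_set G S \<longleftrightarrow> S \<subseteq> pverts G \<and> (\<forall>u\<in>S. \<forall>v\<in>S. (u, v) \<notin> parcs G)"

definition maximal_independent_set :: "'a pair_pre_digraph \<Rightarrow> 'a set \<Rightarrow> bool" where
  "maximal_independent_set G S \<longleftrightarrow>
     independent_set G S \<and> (\<forall>T. independent_set G T \<and> S \<subseteq> T \<longrightarrow> T = S)"

definition well_covered :: "'a pair_pre_digraph \<Rightarrow> bool" where
  "well_covered G \<longleftrightarrow>
     (\<forall>S T. maximal_independent_set G S \<and> maximal_independent_set G T \<longrightarrow> card S = card T)"

definition bipartite :: "'a pair_pre_digraph \<Rightarrow> bool" where
  "bipartite G \<longleftrightarrow>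
     (\<exists>X Y. X \<union> Y = pverts G \<and> X \<inter> Y = {} \<and> independent_set G X \<and> independent_set G Y)"

definition induced_matching :: "'a pair_pre_digraph \<Rightarrow> 'a set set \<Rightarrow> bool" where
  "induced_matching G M \<longleftrightarrow>
     M \<subseteq> uedges G \<and> pairwise disjnt M \<and>
     induced_subgraph (with_proj \<lparr>pverts = \<Union>M, parcs = {(u, v). {u, v} \<in> M}\<rparr>) (with_proj G)"

definition indmatch :: "'a pair_pre_digraph \<Rightarrow> nat" where
  "indmatch G = Max {card M |M. induced_matching G M}"

definition complement_graph :: "'a pair_pre_digraph \<Rightarrow> 'a pair_pre_digraph" where
  "complement_graph G = \<lparr>pverts = pverts G,
     parcs = {(u, v). u \<in> pverts G \<and> v \<in> pverts G \<and> u \<noteq> v \<and> (u, v) \<notin> parcs G}\<rparr>"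

text \<open>
  For a list of \<open>n \<ge> 3\<close> distinct vertices the following is the \<open>n\<close>-cycle visiting them in order.
\<close>

definition cycle_graph :: "'a list \<Rightarrow> 'a pair_pre_digraph" where
  "cycle_graph vs = \<lparr>pverts = set vs,
     parcs = {(vs ! i, vs ! j) |i j. i < length vs \<and> j < length vs \<and>
                (j = Suc i mod length vs \<or> i = Suc j mod length vs)}\<rparr>"

definition chordal :: "'a pair_pre_digraph \<Rightarrow> bool" where
  "chordal G \<longleftrightarrow>
     (\<forall>vs. distinct vs \<and> 3 \<le> length vs \<and> induced_subgraph (with_proj (cycle_graph vs)) (with_proj G)
        \<longrightarrow> length vs = 3)"

definition co_chordal :: "'a pair_pre_digraph \<Rightarrow> bool" where
  "co_chordal G \<longleftrightarrow> chordal (complement_graph G)"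

text \<open>
  The subgraphs in a cover need not be spanning or induced; co-chordality of such an \<open>H\<close> refers to
  the complement of \<open>H\<close> within its own vertex set.
\<close>

definition co_chordal_cover :: "'a pair_pre_digraph \<Rightarrow> 'a pair_pre_digraph set \<Rightarrow> bool" where
  "co_chordal_cover G C \<longleftrightarrow>
     (\<forall>H\<in>C. pair_graph H \<and> subgraph (with_proj H) (with_proj G) \<and> co_chordal H) \<and>
     (\<Union>H\<in>C. uedges H) = uedges G"

definition cochord :: "'a pair_pre_digraph \<Rightarrow> nat" where
  "cochord G = (LEAST k. \<exists>C. finite C \<and> card C = k \<and> co_chordal_cover G C)"

text \<open>
  On a \<^locale>\<open>pair_graph\<close> both invariants are meaningful: the maximum is over a finite nonempty set, and
  a finite co-chordal cover exists.
\<close>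

lemma
  assumes "pair_graph G"
  shows finite_induced_matching_cards: "finite {card M |M. induced_matching G M}"
    and induced_matching_empty: "induced_matching G {}"
proof -
  interpret pair_graph G by fact
  have "uedges G = (\<lambda>(u,v). {u,v}) ` parcs G" by (auto simp: uedges_def)
  then have "finite (uedges G)" using pair_finite_arcs by simp
  then have "finite (card ` Pow (uedges G))" by simp
  then show "finite {card M |M. induced_matching G M}"
    by (rule rev_finite_subset) (auto simp: induced_matching_def)
  show "induced_matching G {}"
    by (auto simp: induced_matching_def induced_subgraph_def subgraph_def compatible_def
        wf_digraph wf_digraph_def wellformed)
qed

lemma pair_graph_complement_graph:
  assumes "pair_graph G" shows "pair_graph (complement_graph G)"
proof -
  interpret pair_graph G by fact
  have "sym (parcs G)" using pair_sym_arcs by (simp add: symmetric_def)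
  moreover have "finite {(u, v). u \<in> pverts G \<and> v \<in> pverts G \<and> u \<noteq> v \<and> (u, v) \<notin> parcs G}"
    by (rule finite_subset[of _ "pverts G \<times> pverts G"]) (auto simp: pair_finite_verts)
  ultimately show ?thesis
    by unfold_locales (auto simp: complement_graph_def symmetric_def sym_def pair_finite_verts)
qed

lemma co_chordal_edge: "co_chordal \<lparr>pverts = {u, v}, parcs = {(u, v), (v, u)}\<rparr>"
  (is "co_chordal ?H")
  unfolding co_chordal_def chordal_def
proof (intro allI impI, elim conjE)
  fix vs
  assume d: "distinct vs" "3 \<le> length vs"
    and i: "induced_subgraph (with_proj (cycle_graph vs)) (with_proj (complement_graph ?H))"
  have "set vs \<subseteq> {u, v}"
    using i by (simp add: induced_subgraph_def subgraph_def cycle_graph_def complement_graph_def)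
  then have "card (set vs) \<le> card {u, v}" by (intro card_mono) auto
  also have "\<dots> \<le> 2" by (simp add: card_insert_if)
  finally show "length vs = 3" using d distinct_card[of vs] by simp
qed

lemma co_chordal_cover_exists:
  assumes "pair_graph G" shows "\<exists>C. finite C \<and> co_chordal_cover G C"
proof -
  interpret pair_graph G by fact
  have s: "(v, u) \<in> parcs G" if "(u, v) \<in> parcs G" for u v
    using pair_sym_arcs that by (auto simp: symmetric_def dest: symD)
  let ?H = "\<lambda>p. \<lparr>pverts = {fst p, snd p}, parcs = {p, (snd p, fst p)}\<rparr>"
  have "pair_graph (?H p) \<and> subgraph (with_proj (?H p)) (with_proj G) \<and> co_chordal (?H p)"
    if p: "p \<in> parcs G" for p
  proof (intro conjI)
    show "pair_graph (?H p)"
      using pair_no_loops[OF p] by unfold_locales (auto simp: symmetric_def sym_def)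
    have "wf_digraph (with_proj (?H p))" by unfold_locales auto
    then show "subgraph (with_proj (?H p)) (with_proj G)"
      using p s[of "fst p" "snd p"] wf_digraph arc_fst_in_verts arc_snd_in_verts
      by (simp add: subgraph_def compatible_def)
    show "co_chordal (?H p)" using co_chordal_edge[of "fst p" "snd p"] by simp
  qed
  then have H: "\<forall>K\<in>?H ` parcs G. pair_graph K \<and> subgraph (with_proj K) (with_proj G) \<and> co_chordal K"
    by (intro ballI) (elim imageE, simp only: simp_thms)
  have e: "uedges (?H p) = {{fst p, snd p}}" for p
    unfolding uedges_def by (cases p) (auto simp: insert_commute)
  have "(\<Union>K\<in>?H ` parcs G. uedges K) = (\<Union>p\<in>parcs G. {{fst p, snd p}})"
    by (simp only: e UN_simps)
  also have "\<dots> = uedges G"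
  proof (intro equalityI subsetI)
    fix x assume "x \<in> (\<Union>p\<in>parcs G. {{fst p, snd p}})"
    then obtain u v where "(u, v) \<in> parcs G" "x = {u, v}" by auto
    then show "x \<in> uedges G" unfolding uedges_def by blast
  next
    fix x assume "x \<in> uedges G"
    then obtain u v where "(u, v) \<in> parcs G" "x = {u, v}" unfolding uedges_def by blast
    then show "x \<in> (\<Union>p\<in>parcs G. {{fst p, snd p}})" by (intro UN_I[of "(u, v)"]) simp_all
  qed
  finally have "co_chordal_cover G (?H ` parcs G)"
    unfolding co_chordal_cover_def using H by (intro conjI)
  then show ?thesis using pair_finite_arcs by (intro exI[of _ "?H ` parcs G"]) simp
qed

end

theory Submission
  imports Defs
begin

text \<open>
  Two edges without connecting edges in a graph \<open>H\<close> span a 4-cycle in the complement of \<open>H\<close>, so a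
  co-chordal subgraph contains at most one edge of an induced matching; this gives
  \<open>indmatch G \<le> cochord G\<close>. Conversely, let \<open>X'\<close> be the non-isolated vertices of one side. By
  well-coveredness Hall's condition holds, and the resulting matching \<open>m\<close> satisfies
  \<open>N x \<subseteq> N x'\<close> whenever \<open>x'\<close> is adjacent to \<open>m x\<close>. Hence an antichain in the preorder
  \<open>N x \<subseteq> N x'\<close> on \<open>X'\<close> yields an induced matching of the same size, while the edges at a chain form
  a bipartite graph with nested neighbourhoods, which is co-chordal. Dilworth's theorem for this
  preorder finishes the proof.
\<close>

section \<open>Hall's marriage theorem\<close>

text \<open>Induction on \<open>card X\<close>. If some nonempty proper subset \<open>J\<close> is
  tight, having exactly \<open>card J\<close> neighbours, then \<open>J\<close> and
  \<open>X - J\<close> are matched separately. Otherwise any one pair can be fixed, since every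
  nonempty proper subset has a neighbour to spare.\<close>

lemma hall_marriage:
  assumes "finite X" "\<And>x. x \<in> X \<Longrightarrow> finite (F x)"
    and "\<And>J. J \<subseteq> X \<Longrightarrow> card J \<le> card (\<Union>(F ` J))"
  shows "\<exists>m. inj_on m X \<and> (\<forall>x\<in>X. m x \<in> F x)"
  using assms
proof (induction "card X" arbitrary: X F rule: less_induct)
  case less
  note fin = \<open>finite X\<close>
  have finU: "finite (\<Union>(F ` J))" if "J \<subseteq> X" for J
    using that less.prems fin by (auto intro: finite_subset)
  show ?case
  proof (cases "X = {}")
    case True
    then show ?thesis by simp
  next
    case False
    then obtain x where x: "x \<in> X" by blast
    show ?thesis
    proof (cases "\<exists>J. J \<subset> X \<and> J \<noteq> {} \<and> card J = card (\<Union>(F ` J))")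
      case True
      then obtain J where J: "J \<subset> X" "J \<noteq> {}" "card J = card (\<Union>(F ` J))" by blast
      have fJ: "finite J" using J fin finite_subset by blast
      have "\<exists>m. inj_on m J \<and> (\<forall>x\<in>J. m x \<in> F x)"
      proof (rule less.hyps)
        show "card J < card X" using J fin psubset_card_mono by blast
      qed (use J fJ less.prems in auto)
      then obtain m1 where m1: "inj_on m1 J" "\<forall>x\<in>J. m1 x \<in> F x" by blast
      \<comment> \<open>The neighbours of \<open>J\<close> are all used up by \<open>J\<close>.
        Hall's condition survives for the rest: apply it to \<open>J \<union> K\<close> and cancel
        the contribution of the tight set \<open>J\<close>.\<close>
      let ?G = "\<lambda>x. F x - \<Union>(F ` J)"
      have "\<exists>m. inj_on m (X - J) \<and> (\<forall>x\<in>X - J. m x \<in> ?G x)"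
      proof (rule less.hyps)
        show "card (X - J) < card X"
          using J fin by (intro psubset_card_mono) auto
        show "card K \<le> card (\<Union>(?G ` K))" if K: "K \<subseteq> X - J" for K
        proof -
          have fK: "finite K" using K fin finite_subset by blast
          have "card J + card K = card (J \<union> K)"
            using K fJ fK by (subst card_Un_disjoint) auto
          also have "\<dots> \<le> card (\<Union>(F ` (J \<union> K)))" using K J by (intro less.prems) auto
          also have "\<Union>(F ` (J \<union> K)) = \<Union>(F ` J) \<union> \<Union>(?G ` K)" by auto
          also have "card \<dots> \<le> card (\<Union>(F ` J)) + card (\<Union>(?G ` K))" by (rule card_Un_le)
          finally show ?thesis using J by simp
        qed
      qed (use fin less.prems in auto)
      then obtain m2 where m2: "inj_on m2 (X - J)" "\<forall>x\<in>X - J. m2 x \<in> ?G x" by blast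
      let ?m = "\<lambda>x. if x \<in> J then m1 x else m2 x"
      have "inj_on ?m X"
      proof -
        have "m1 ` J \<inter> m2 ` (X - J) = {}" using m1 m2 by fastforce
        from inj_on_disjoint_Un[OF m1(1) m2(1) this] show ?thesis
          using J by (simp add: Un_absorb1 psubset_imp_subset)
      qed
      moreover have "\<forall>x\<in>X. ?m x \<in> F x" using m1 m2 by auto
      ultimately show ?thesis by blast
    next
      case False
      have "card (F x) \<ge> 1" using less.prems(3)[of "{x}"] x by simp
      then obtain y where y: "y \<in> F x" by fastforce
      \<comment> \<open>Without tight subsets, each nonempty \<open>K\<close> has more neighbours
        than elements, and deleting \<open>y\<close> costs at most one.\<close>
      let ?G = "\<lambda>z. F z - {y}"
      have "\<exists>m. inj_on m (X - {x}) \<and> (\<forall>z\<in>X - {x}. m z \<in> ?G z)"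
      proof (rule less.hyps)
        show "card (X - {x}) < card X" using fin x by (rule card_Diff1_less)
        show "card K \<le> card (\<Union>(?G ` K))" if K: "K \<subseteq> X - {x}" for K
        proof (cases "K = {}")
          case ne: False
          have "K \<subset> X" using K x by auto
          then have "card K < card (\<Union>(F ` K))"
            using False ne less.prems(3)[of K] by (metis le_neq_trans psubset_imp_subset)
          moreover have "\<Union>(?G ` K) = \<Union>(F ` K) - {y}" by auto
          moreover have "finite (\<Union>(F ` K))" using K by (intro finU) auto
          ultimately show ?thesis by (auto simp: card_Diff_singleton_if)
        qed simp
      qed (use fin less.prems in auto)
      then obtain m where m: "inj_on m (X - {x})" "\<forall>z\<in>X - {x}. m z \<in> ?G z" by blast
      have "inj_on (m(x := y)) X"
        using m by (intro inj_onI) (auto simp: inj_on_def split: if_splits)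
      moreover have "\<forall>z\<in>X. (m(x := y)) z \<in> F z" using m y by auto
      ultimately show ?thesis by blast
    qed
  qed
qed

section \<open>Dilworth's theorem for preorders\<close>

text \<open>An element with the most elements of \<open>S\<close> below it works: going up can only
  enlarge the down-set, so any element above it has the same down-set and, by reflexivity, lies in
  it.\<close>

lemma ex_maximal_preorder:
  assumes "finite S" "S \<noteq> {}"
    and trans: "\<And>x y z. r x y \<Longrightarrow> r y z \<Longrightarrow> r x z" and refl: "\<And>x. r x x"
  shows "\<exists>a\<in>S. \<forall>y\<in>S. r a y \<longrightarrow> r y a"
proof -
  let ?c = "\<lambda>a. card {z\<in>S. r z a}"
  have "Max (?c ` S) \<in> ?c ` S" using assms(1,2) by simp
  then obtain a where a: "a \<in> S" "Max (?c ` S) = ?c a" by blast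
  have "r y a" if y: "y \<in> S" "r a y" for y
  proof -
    have "?c y \<le> ?c a" unfolding a(2)[symmetric] using assms(1) y(1) by simp
    moreover have "{z\<in>S. r z a} \<subseteq> {z\<in>S. r z y}" using trans[OF _ y(2)] by blast
    ultimately have "{z\<in>S. r z a} = {z\<in>S. r z y}"
      using assms(1) by (intro card_seteq) auto
    moreover have "y \<in> {z\<in>S. r z y}" using y(1) refl[of y] by blast
    ultimately show ?thesis by blast
  qed
  then show ?thesis using a(1) by blast
qed

text \<open>Galvin's proof, for preorders: two equivalent elements count as comparable.\<close>

lemma dilworth:
  fixes r :: "'b \<Rightarrow> 'b \<Rightarrow> bool"
  assumes "finite A" and refl: "\<And>x. r x x" and trans: "\<And>x y z. r x y \<Longrightarrow> r y z \<Longrightarrow> r x z"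
  shows "\<exists>B (f :: 'b \<Rightarrow> nat). B \<subseteq> A \<and> (\<forall>x\<in>B. \<forall>y\<in>B. x \<noteq> y \<longrightarrow> \<not> r x y) \<and>
    f ` A \<subseteq> {..<card B} \<and> (\<forall>x\<in>A. \<forall>y\<in>A. f x = f y \<longrightarrow> r x y \<or> r y x)"
  using \<open>finite A\<close>
proof (induction "card A" arbitrary: A rule: less_induct)
  case less
  note fin = \<open>finite A\<close>
  define anti where "anti = (\<lambda>B. \<forall>x\<in>B. \<forall>y\<in>B. x \<noteq> y \<longrightarrow> \<not> r x y)"
  define chains where "chains = (\<lambda>A (f :: 'b \<Rightarrow> nat) k. f ` A \<subseteq> {..<k} \<and>
    (\<forall>x\<in>A. \<forall>y\<in>A. f x = f y \<longrightarrow> r x y \<or> r y x))"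
  have IH: "\<exists>B f. B \<subseteq> A' \<and> anti B \<and> chains A' f (card B)" if "A' \<subset> A" for A'
    unfolding anti_def chains_def
  proof (rule less.hyps)
    show "card A' < card A" using fin that by (rule psubset_card_mono)
    show "finite A'" using fin that by (blast intro: finite_subset)
  qed
  \<comment> \<open>A chain \<open>K\<close> removed from \<open>A\<close> returns as one further
    class; the label \<open>k\<close> is free because \<open>g\<close> uses only labels below
    \<open>k\<close> on \<open>A - K\<close>.\<close>
  have extend: "\<exists>f. chains A f (Suc k)" if "chains (A - K) g k" "\<forall>x\<in>K. \<forall>y\<in>K. r x y \<or> r y x" for K g k
  proof -
    let ?h = "\<lambda>x. if x \<in> K then k else g x"
    have lt: "g x < k" if "x \<in> A - K" for x
      using that \<open>chains (A - K) g k\<close> unfolding chains_def by blast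
    have "r x y \<or> r y x" if "x \<in> A" "y \<in> A" "?h x = ?h y" for x y
    proof (cases "x \<in> K")
      case True
      then have "y \<in> K" using that lt[of y] by (auto split: if_splits)
      then show ?thesis using True \<open>\<forall>x\<in>K. \<forall>y\<in>K. r x y \<or> r y x\<close> by blast
    next
      case False
      then have "y \<notin> K" using that lt[of x] by (auto split: if_splits)
      then show ?thesis using False that \<open>chains (A - K) g k\<close> unfolding chains_def by auto
    qed
    moreover have "?h ` A \<subseteq> {..<Suc k}" using lt by (auto simp: less_Suc_eq)
    ultimately show ?thesis unfolding chains_def by blast
  qed
  have top: "\<exists>a\<in>S. \<forall>y\<in>S. r a y \<longrightarrow> r y a" if "finite S" "S \<noteq> {}" for S
    using that trans refl by (rule ex_maximal_preorder)
  have "\<exists>B f. B \<subseteq> A \<and> anti B \<and> chains A f (card B)"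
  proof (cases "A = {}")
    case True
    then show ?thesis by (auto simp: anti_def chains_def)
  next
    case False
    \<comment> \<open>Galvin's induction removes a maximal element \<open>a\<close>; the rest splits
      into \<open>k\<close> chains, where \<open>k\<close> is the size of an antichain
      \<open>B0\<close>.\<close>
    then obtain a where a: "a \<in> A" "\<forall>y\<in>A. r a y \<longrightarrow> r y a" using top[OF fin False] by blast
    obtain B0 f where B0: "B0 \<subseteq> A - {a}" "anti B0" and f: "chains (A - {a}) f (card B0)"
      using IH[of "A - {a}"] a by blast
    define k where "k = card B0"
    have comparable: "r x y \<or> r y x" if "x \<in> A - {a}" "y \<in> A - {a}" "f x = f y" for x y
      using f that unfolding chains_def by blast
    have flt: "f ` (A - {a}) \<subseteq> {..<k}" using f unfolding chains_def k_def by (rule conjunct1)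
    have antiD: "x = y" if "anti D" "x \<in> D" "y \<in> D" "r x y" for D x y
      using that unfolding anti_def by blast
    let ?P = "\<lambda>D. D \<subseteq> A - {a} \<and> anti D \<and> card D = k"
    \<comment> \<open>An antichain has at most one element in each chain, so one of size
      \<open>k\<close> meets all \<open>k\<close> chains.\<close>
    have meets: "\<exists>y\<in>D. f y = i" if D: "?P D" and i: "i < k" for D i
    proof -
      have "inj_on f D"
      proof (rule inj_onI)
        fix x y assume xy: "x \<in> D" "y \<in> D" "f x = f y"
        then have "r x y \<or> r y x" using D by (intro comparable) auto
        then show "x = y" using antiD[of D x y] antiD[of D y x] D xy by blast
      qed
      then have "card (f ` D) = card {..<k}" using D by (simp add: card_image)
      moreover have "f ` D \<subseteq> {..<k}" using D flt by blast
      ultimately have "f ` D = {..<k}" by (simp add: card_subset_eq)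
      then show ?thesis using i by (metis imageE lessThan_iff)
    qed
    \<comment> \<open>\<open>t i\<close> will be a topmost element of chain \<open>i\<close> among
      those lying on some antichain of size \<open>k\<close>. Elements of one chain are comparable,
      so a maximal one is above all the others.\<close>
    have "\<exists>x. (\<exists>D. ?P D \<and> x \<in> D) \<and> f x = i \<and> (\<forall>D y. ?P D \<and> y \<in> D \<and> f y = i \<longrightarrow> r y x)"
      if i: "i < k" for i
    proof -
      define S where "S = {x. f x = i \<and> (\<exists>D. ?P D \<and> x \<in> D)}"
      have "S \<subseteq> A" unfolding S_def by auto
      then have "finite S" using fin finite_subset by blast
      moreover have "S \<noteq> {}" using meets[of B0 i] i B0 unfolding S_def k_def by blast
      ultimately have "\<exists>x\<in>S. \<forall>y\<in>S. r x y \<longrightarrow> r y x" by (rule top)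
      then obtain x where x: "x \<in> S" "\<forall>y\<in>S. r x y \<longrightarrow> r y x" by blast
      have "r y x" if "y \<in> S" for y
      proof -
        have "r x y \<or> r y x" using x(1) that unfolding S_def by (intro comparable) auto
        then show ?thesis using x(2) that by blast
      qed
      then show ?thesis using x(1) unfolding S_def by blast
    qed
    then obtain t where t: "\<And>i. i < k \<Longrightarrow> \<exists>D. ?P D \<and> t i \<in> D" "\<And>i. i < k \<Longrightarrow> f (t i) = i"
      "\<And>i D y. i < k \<Longrightarrow> ?P D \<Longrightarrow> y \<in> D \<Longrightarrow> f y = i \<Longrightarrow> r y (t i)"
      by metis
    define B where "B = t ` {..<k}"
    have tA: "t i \<in> A - {a}" if "i < k" for i using t(1)[OF that] by blast
    have BA: "B \<subseteq> A - {a}" unfolding B_def using tA by auto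
    have cB: "card B = k" unfolding B_def using t(2) by (subst card_image) (auto intro: inj_on_inverseI)
    \<comment> \<open>An antichain \<open>D\<close> through \<open>t i\<close> has a member
      \<open>y\<close> in chain \<open>j\<close>, and \<open>y\<close> is below \<open>t j\<close>.
      If \<open>t j\<close> were below \<open>t i\<close>, two distinct members of \<open>D\<close>
      would be comparable.\<close>
    have "\<not> r (t j) (t i)" if ij: "i < k" "j < k" "i \<noteq> j" for i j
    proof
      assume r: "r (t j) (t i)"
      obtain D where D: "?P D" "t i \<in> D" using t(1) ij by blast
      obtain y where y: "y \<in> D" "f y = j" using meets D ij by blast
      have "r y (t i)" by (rule trans[OF t(3)[OF ij(2) D(1) y] r])
      moreover have "y \<noteq> t i" using t(2) ij y by metis
      ultimately show False using antiD[OF _ y(1) D(2)] D(1) by blast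
    qed
    then have aB: "anti B" unfolding anti_def B_def by (metis imageE lessThan_iff)
    show ?thesis
    proof (cases "\<exists>i<k. r (t i) a")
      case True
      then obtain i where i: "i < k" "r (t i) a" by blast
      \<comment> \<open>The part of chain \<open>i\<close> below \<open>t i\<close>, with
        \<open>a\<close> on top. Every antichain of size \<open>k\<close> in \<open>A - {a}\<close>
        meets chain \<open>i\<close> inside \<open>K\<close>, so antichains of \<open>A - K\<close>
        have fewer than \<open>k\<close> elements and the induction leaves room for \<open>K\<close>
        as one more chain.\<close>
      define K where "K = insert a {z\<in>A - {a}. f z = i \<and> r z (t i)}"
      have Kch: "\<forall>x\<in>K. \<forall>y\<in>K. r x y \<or> r y x"
      proof -
        have "r z a" if "z \<in> K" for z
          using that trans[OF _ i(2), of z] refl[of a] unfolding K_def by blast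
        moreover have "r x y \<or> r y x" if "x \<in> K - {a}" "y \<in> K - {a}" for x y
          using that unfolding K_def by (intro comparable) auto
        ultimately show ?thesis by blast
      qed
      have "A - K \<subset> A" using a(1) unfolding K_def by blast
      from IH[OF this] obtain B1 g
        where B1: "B1 \<subseteq> A - K" "anti B1" "chains (A - K) g (card B1)" by blast
      have B1A: "B1 \<subseteq> A - {a}" using B1(1) unfolding K_def by blast
      have "card B1 < k"
      proof (rule ccontr)
        assume "\<not> card B1 < k"
        \<comment> \<open>\<open>?P\<close> demands size exactly \<open>k\<close>, so a larger
          antichain is first cut down.\<close>
        then obtain D where D: "D \<subseteq> B1" "card D = k" by (meson not_less obtain_subset_with_card_n)
        then have "anti D" using B1(2) unfolding anti_def by (meson subsetD)
        then have P: "?P D" using B1A D by blast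
        obtain y where y: "y \<in> D" "f y = i" using meets[OF P i(1)] by blast
        have "r y (t i)" using t(3)[OF i(1) P y] .
        then have "y \<in> K" using y P unfolding K_def by blast
        then show False using y(1) D(1) B1(1) by blast
      qed
      obtain h where "chains A h (Suc (card B1))" using extend[OF B1(3) Kch] ..
      moreover have "{..<Suc (card B1)} \<subseteq> {..<card B}" using \<open>card B1 < k\<close> cB by auto
      ultimately have "chains A h (card B)" unfolding chains_def by (meson subset_trans)
      then show ?thesis using aB BA by blast
    next
      case False
      \<comment> \<open>Now \<open>B\<close> together with \<open>a\<close> is an antichain of size
        \<open>k + 1\<close>, matched by the extra chain \<open>{a}\<close>. The relation
        \<open>r a x\<close> is excluded too, since maximality of \<open>a\<close> would turn it
        into \<open>r x a\<close>.\<close>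
      have "\<not> r x a" if "x \<in> B" for x using False that unfolding B_def by blast
      moreover have "\<not> r a x" if "x \<in> B" for x using calculation[OF that] a(2) BA that by blast
      ultimately have anti: "anti (insert a B)" using aB unfolding anti_def by blast
      have "finite B" unfolding B_def by simp
      moreover have "a \<notin> B" using BA by blast
      ultimately have "card (insert a B) = Suc k" using cB by simp
      moreover have "\<exists>h. chains A h (Suc k)"
        by (rule extend[of "{a}" f]) (use f refl k_def in auto)
      moreover have "insert a B \<subseteq> A" using a(1) BA by blast
      ultimately show ?thesis using anti by metis
    qed
  qed
  then show ?case unfolding anti_def chains_def .
qed

section \<open>Cycles in the complement and co-chordality\<close>

lemma parcs_cycle_graph_iff:
  assumes "distinct vs" "i < length vs" "j < length vs"
  shows "(vs ! i, vs ! j) \<in> parcs (cycle_graph vs) \<longleftrightarrow>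
    j = Suc i mod length vs \<or> i = Suc j mod length vs"
  using assms by (auto simp: cycle_graph_def nth_eq_iff_index_eq)

lemma parcs_cycle_graph:
  "parcs (cycle_graph vs) = (\<Union>i\<in>{..<length vs}.
    {(vs ! i, vs ! (Suc i mod length vs)), (vs ! (Suc i mod length vs), vs ! i)})" (is "?L = ?R")
proof
  show "?L \<subseteq> ?R" unfolding cycle_graph_def by auto
  have "(vs ! i, vs ! (Suc i mod length vs)) \<in> ?L \<and> (vs ! (Suc i mod length vs), vs ! i) \<in> ?L"
    if "i < length vs" for i
  proof -
    have "Suc i mod length vs < length vs" using that by (intro mod_less_divisor) auto
    then show ?thesis using that unfolding cycle_graph_def by auto
  qed
  then show "?R \<subseteq> ?L" by blast
qed

lemma wf_digraph_cycle_graph: "wf_digraph (with_proj (cycle_graph vs))"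
  by unfold_locales (auto simp: cycle_graph_def)

text \<open>Without an arc between the two edges, \<open>a, c, b, d\<close> would be an induced
  4-cycle of the complement, whose missing diagonals are the two edges.\<close>

lemma co_chordal_no_2K2:
  assumes "pair_graph H" "co_chordal H" and e: "(a, b) \<in> parcs H" "(c, d) \<in> parcs H"
    and disj: "{a, b} \<inter> {c, d} = {}"
  shows "\<exists>u\<in>{a, b}. \<exists>v\<in>{c, d}. (u, v) \<in> parcs H"
proof (rule ccontr)
  interpret pair_graph H by fact
  assume "\<not> ?thesis"
  then have n: "(a, c) \<notin> parcs H" "(a, d) \<notin> parcs H" "(b, c) \<notin> parcs H" "(b, d) \<notin> parcs H"
    "(c, a) \<notin> parcs H" "(d, a) \<notin> parcs H" "(c, b) \<notin> parcs H" "(d, b) \<notin> parcs H"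
    using arcs_symmetric by auto
  have s: "(b, a) \<in> parcs H" "(d, c) \<in> parcs H" using arcs_symmetric e by auto
  have ne: "a \<noteq> b" "c \<noteq> d" using no_loops' e by auto
  have V: "a \<in> pverts H" "b \<in> pverts H" "c \<in> pverts H" "d \<in> pverts H"
    using e wellformed' by blast+
  let ?vs = "[a, c, b, d]"
  interpret C: pair_graph "complement_graph H" by (rule pair_graph_complement_graph) fact
  have len: "{..<length ?vs} = {0, 1, 2, 3::nat}" by auto
  have cyc: "parcs (cycle_graph ?vs) =
      {(a, c), (c, a), (c, b), (b, c), (b, d), (d, b), (d, a), (a, d)}"
    unfolding parcs_cycle_graph len by (simp add: insert_commute)
  have "induced_subgraph (with_proj (cycle_graph ?vs)) (with_proj (complement_graph H))"
    unfolding induced_subgraph_def subgraph_def compatible_def with_proj_simps cyc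
  proof (intro conjI)
    show "pverts (cycle_graph ?vs) \<subseteq> pverts (complement_graph H)"
      using V by (simp add: cycle_graph_def complement_graph_def)
    show "{(a, c), (c, a), (c, b), (b, c), (b, d), (d, b), (d, a), (a, d)} =
      {e \<in> parcs (complement_graph H). fst e \<in> pverts (cycle_graph ?vs) \<and> snd e \<in> pverts (cycle_graph ?vs)}"
      (is "?L = ?R")
    proof
      have "a \<noteq> c" "a \<noteq> d" "b \<noteq> c" "b \<noteq> d" using disj by blast+
      then show "?L \<subseteq> ?R" using V n by (simp add: cycle_graph_def complement_graph_def)
      show "?R \<subseteq> ?L"
      proof
        fix p assume p: "p \<in> ?R"
        obtain u v where uv: "p = (u, v)" by (cases p)
        have "u \<in> {a, c, b, d}" "v \<in> {a, c, b, d}" "u \<noteq> v" "(u, v) \<notin> parcs H"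
          using p uv by (simp_all add: cycle_graph_def complement_graph_def)
        then show "p \<in> ?L" unfolding uv
          by (elim insertE emptyE) (use s e in simp_all)
      qed
    qed
    then show "{(a, c), (c, a), (c, b), (b, c), (b, d), (d, b), (d, a), (a, d)} \<subseteq> parcs (complement_graph H)"
      by blast
  qed (use wf_digraph_cycle_graph C.wf_digraph in auto)
  moreover have "distinct ?vs" using ne disj by auto
  moreover have "3 \<le> length ?vs" "length ?vs \<noteq> 3" by simp_all
  ultimately show False using \<open>co_chordal H\<close> unfolding co_chordal_def chordal_def by blast
qed

text \<open>The condition \<open>nested\<close> says elementwise that the neighbourhoods of any two
  vertices of \<open>A\<close> are comparable under inclusion. It excludes induced 4-cycles of the
  complement; longer induced cycles are excluded by bipartiteness alone.\<close>

lemma co_chordal_bipartite_nested: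
  fixes H :: "'a pair_pre_digraph"
  assumes "pair_graph H" and AB: "A \<union> B = pverts H" "independent_set H A" "independent_set H B"
    and nested: "\<And>a b a' b'. a \<in> A \<Longrightarrow> a' \<in> A \<Longrightarrow> (a, b) \<in> parcs H \<Longrightarrow> (a', b') \<in> parcs H \<Longrightarrow>
      (a, b') \<in> parcs H \<or> (a', b) \<in> parcs H"
  shows "co_chordal H"
  unfolding co_chordal_def chordal_def
proof (intro allI impI, elim conjE)
  interpret pair_graph H by fact
  fix vs :: "'a list"
  let ?n = "length vs"
  assume d: "distinct vs" and n: "3 \<le> ?n"
    and ind: "induced_subgraph (with_proj (cycle_graph vs)) (with_proj (complement_graph H))"
  have V: "set vs \<subseteq> pverts H"
    using ind by (simp add: induced_subgraph_def subgraph_def cycle_graph_def complement_graph_def)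
  have arcs: "parcs (cycle_graph vs) = {e \<in> parcs (complement_graph H). fst e \<in> set vs \<and> snd e \<in> set vs}"
    using ind by (simp add: induced_subgraph_def cycle_graph_def)
  \<comment> \<open>Seen in \<open>H\<close>, adjacency on the cycle is reversed: edges join exactly
    the distinct non-consecutive positions.\<close>
  have adj: "(vs ! i, vs ! j) \<in> parcs H \<longleftrightarrow> \<not> (j = Suc i mod ?n \<or> i = Suc j mod ?n)"
    if "i < ?n" "j < ?n" "i \<noteq> j" for i j
  proof -
    have "vs ! i \<in> set vs" "vs ! j \<in> set vs" "vs ! i \<noteq> vs ! j"
      using that d by (auto simp: nth_eq_iff_index_eq)
    then have "(vs ! i, vs ! j) \<in> parcs (cycle_graph vs) \<longleftrightarrow> (vs ! i, vs ! j) \<notin> parcs H"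
      using V unfolding arcs by (auto simp: complement_graph_def)
    then show ?thesis using parcs_cycle_graph_iff[OF d that(1,2)] by blast
  qed
  have side: "u \<in> A \<longleftrightarrow> v \<notin> A" if "(u, v) \<in> parcs H" for u v
    using that AB wellformed'[OF that] unfolding independent_set_def by blast
  show "?n = 3"
  proof (rule ccontr)
    assume "?n \<noteq> 3"
    then consider "?n = 4" | "?n \<ge> 5" using n by linarith
    then show False
    proof cases
      case 1
      have p: "(vs ! 0, vs ! 2) \<in> parcs H" "(vs ! 1, vs ! 3) \<in> parcs H"
        and q: "(vs ! 0, vs ! 1) \<notin> parcs H" "(vs ! 1, vs ! 2) \<notin> parcs H"
          "(vs ! 2, vs ! 3) \<notin> parcs H" "(vs ! 3, vs ! 0) \<notin> parcs H"
        using 1 by (simp_all add: adj)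
      have p': "(vs ! 2, vs ! 0) \<in> parcs H" "(vs ! 3, vs ! 1) \<in> parcs H"
        and q': "(vs ! 1, vs ! 0) \<notin> parcs H" "(vs ! 2, vs ! 1) \<notin> parcs H"
          "(vs ! 3, vs ! 2) \<notin> parcs H" "(vs ! 0, vs ! 3) \<notin> parcs H"
        using p q arcs_symmetric by blast+
      \<comment> \<open>Each diagonal has exactly one end in \<open>A\<close>; this gives four
        cases, and in each \<open>nested\<close> would force an edge along the cycle.\<close>
      consider "vs ! 0 \<in> A" "vs ! 1 \<in> A" | "vs ! 0 \<in> A" "vs ! 3 \<in> A"
        | "vs ! 2 \<in> A" "vs ! 1 \<in> A" | "vs ! 2 \<in> A" "vs ! 3 \<in> A"
        using side[OF p(1)] side[OF p(2)] by blast
      then show False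
      proof cases
        case 1 then show False using nested[OF 1 p(1) p(2)] q q' by blast
      next
        case 2 then show False using nested[OF 2 p(1) p'(2)] q q' by blast
      next
        case 3 then show False using nested[OF 3 p'(1) p(2)] q q' by blast
      next
        case 4 then show False using nested[OF 4 p'(1) p'(2)] q q' by blast
      qed
    next
      case 2
      \<comment> \<open>the chords of the cycle contain the closed walk 0, 2, 4, 1, 3 of length 5\<close>
      have m: "Suc i mod ?n = Suc i" if "i < 4" for i using that 2 by simp
      \<comment> \<open>The successor of position 4 wraps to 0 when the cycle has length 5 and is 5
        otherwise; in both cases it differs from 1 and 2.\<close>
      have m4: "Suc 4 mod ?n \<in> {0, 5}"
        using 2 by (cases "?n = 5") auto
      have "(vs ! 0, vs ! 2) \<in> parcs H" "(vs ! 2, vs ! 4) \<in> parcs H" "(vs ! 4, vs ! 1) \<in> parcs H"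
        "(vs ! 1, vs ! 3) \<in> parcs H" "(vs ! 3, vs ! 0) \<in> parcs H"
        using 2 m[of 0] m[of 1] m[of 2] m[of 3] m4 by (subst adj; force)+
      \<comment> \<open>Membership in \<open>A\<close> alternates along edges, which is impossible
        around an odd closed walk.\<close>
      then show False using side by blast
    qed
  qed
qed

section \<open>Lower bound for co-chordal covers\<close>

text \<open>Sending each matching edge to a member of the cover that contains it is injective,
  because a co-chordal graph cannot contain two edges of an induced matching.\<close>

lemma card_induced_matching_le_cover:
  assumes M: "induced_matching G M" and C: "co_chordal_cover G C" "finite C"
  shows "card M \<le> card C"
proof -
  have "\<exists>H. H \<in> C \<and> e \<in> uedges H" if "e \<in> M" for e
    using that M C unfolding induced_matching_def co_chordal_cover_def by blast
  then obtain h where h: "\<And>e. e \<in> M \<Longrightarrow> h e \<in> C" "\<And>e. e \<in> M \<Longrightarrow> e \<in> uedges (h e)" by metis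
  have ind: "{u, v} \<in> M" if "(u, v) \<in> parcs G" "u \<in> \<Union>M" "v \<in> \<Union>M" for u v
  proof -
    have "{(u, v). {u, v} \<in> M} = {e \<in> parcs G. fst e \<in> \<Union>M \<and> snd e \<in> \<Union>M}"
      using M unfolding induced_matching_def induced_subgraph_def by simp
    moreover have "(u, v) \<in> \<dots>" using that by simp
    ultimately have "(u, v) \<in> {(u, v). {u, v} \<in> M}" by (rule ssubst)
    then show ?thesis by simp
  qed
  have disj: "e = e'" if "e \<in> M" "e' \<in> M" "x \<in> e" "x \<in> e'" for e e' x
    using M that unfolding induced_matching_def pairwise_def disjnt_def by blast
  have "inj_on h M"
  proof (rule inj_onI, rule ccontr)
    fix e e' assume e: "e \<in> M" "e' \<in> M" "h e = h e'" "e \<noteq> e'"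
    let ?H = "h e"
    have H: "pair_graph ?H" "co_chordal ?H" "parcs ?H \<subseteq> parcs G"
      using h(1)[OF e(1)] C unfolding co_chordal_cover_def subgraph_def by auto
    obtain a b where ab: "e = {a, b}" "(a, b) \<in> parcs ?H"
      using h(2)[OF e(1)] unfolding uedges_def by blast
    obtain c d where cd: "e' = {c, d}" "(c, d) \<in> parcs ?H"
      using h(2)[OF e(2)] e(3) unfolding uedges_def by auto
    have "{a, b} \<inter> {c, d} = {}" using disj[OF e(1,2)] e(4) ab cd by blast
    \<comment> \<open>The arc found between \<open>e\<close> and \<open>e'\<close> joins matched
      vertices, so it belongs to the induced matching; meeting both edges, it must equal
      both.\<close>
    from co_chordal_no_2K2[OF H(1,2) ab(2) cd(2) this]
    obtain u v where uv: "u \<in> e" "v \<in> e'" "(u, v) \<in> parcs G" using ab cd H(3) by blast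
    then have "{u, v} \<in> M" using ind e by blast
    then have "e = {u, v}" "e' = {u, v}" using disj e uv by blast+
    then show False using e by simp
  qed
  then show ?thesis using h(1) C(2) by (intro card_inj_on_le) auto
qed

section \<open>Matchings in well-covered bipartite graphs\<close>

lemma ex_maximal_independent_set_superset:
  assumes "pair_graph G" "independent_set G S"
  shows "\<exists>T. maximal_independent_set G T \<and> S \<subseteq> T"
proof -
  interpret pair_graph G by fact
  have "finite (Collect (independent_set G))"
    by (rule finite_subset[of _ "Pow (pverts G)"]) (auto simp: independent_set_def pair_finite_verts)
  from finite_has_maximal2[OF this, of S] assms(2) obtain T
    where T: "independent_set G T" "S \<subseteq> T" "\<And>U. independent_set G U \<Longrightarrow> T \<subseteq> U \<Longrightarrow> T = U"
    by auto
  then have "maximal_independent_set G T" unfolding maximal_independent_set_def by blast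
  then show ?thesis using T(2) by blast
qed

text \<open>Both claims come from comparison with \<open>Z\<close>, which is \<open>Y\<close> plus
  the isolated vertices of \<open>X\<close>. It is a maximal independent set, so well-coveredness
  gives every maximal independent set the size of \<open>Z\<close>.\<close>

lemma well_covered_bipartite_matching:
  fixes G :: "'a pair_pre_digraph"
  assumes "pair_graph G" and wc: "well_covered G"
    and XY: "X \<union> Y = pverts G" "X \<inter> Y = {}" "independent_set G X" "independent_set G Y"
  defines "X' \<equiv> {x \<in> X. \<exists>y. (x, y) \<in> parcs G}"
  shows "\<exists>m. inj_on m X' \<and> (\<forall>x\<in>X'. (x, m x) \<in> parcs G) \<and>
    (\<forall>x\<in>X'. \<forall>x'\<in>X'. (x', m x) \<in> parcs G \<longrightarrow> parcs G `` {x} \<subseteq> parcs G `` {x'})"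
proof -
  interpret pair_graph G by fact
  define N where "N = (\<lambda>x. parcs G `` {x})"
  define Z where "Z = pverts G - X'"
  have X'X: "X' \<subseteq> X" unfolding X'_def by blast
  have XE: "(u, v) \<notin> parcs G" if "u \<in> X" "v \<in> X" for u v
    using that XY(3) unfolding independent_set_def by blast
  have YE: "(u, v) \<notin> parcs G" if "u \<in> Y" "v \<in> Y" for u v
    using that XY(4) unfolding independent_set_def by blast
  have NY: "N x \<subseteq> Y" if "x \<in> X" for x
    using XE[OF that] wellformed' XY(1) unfolding N_def by blast
  have YZ: "Y \<subseteq> Z" using XY X'X unfolding Z_def by blast
  have ZE: "(u, v) \<notin> parcs G" if "u \<in> Z" "v \<in> Z" for u v
  proof
    assume e: "(u, v) \<in> parcs G"
    have "u \<in> Y" using that(1) XY(1) e unfolding Z_def X'_def by blast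
    moreover have "v \<in> Y" using that(2) XY(1) arcs_symmetric[OF e] unfolding Z_def X'_def by blast
    ultimately show False using YE e by blast
  qed
  have finX': "finite X'" and finZ: "finite Z"
    using finite_subset[OF _ pair_finite_verts, of X'] pair_finite_verts XY(1) X'X
    unfolding Z_def by blast+
  have "maximal_independent_set G Z"
    unfolding maximal_independent_set_def
  proof (intro conjI allI impI)
    show "independent_set G Z" unfolding independent_set_def using ZE Z_def by blast
    fix T assume T: "independent_set G T \<and> Z \<subseteq> T"
    have "x \<in> Z" if "x \<in> T" for x
    proof (rule ccontr)
      assume "x \<notin> Z"
      moreover have "x \<in> pverts G" using T that unfolding independent_set_def by blast
      ultimately have x: "x \<in> X'" unfolding Z_def by blast
      then obtain y where y: "(x, y) \<in> parcs G" unfolding X'_def by blast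
      then have "y \<in> T" using NY[of x] x X'X YZ T unfolding N_def by blast
      then show False using y T that unfolding independent_set_def by blast
    qed
    then show "T = Z" using T by blast
  qed
  then have cardT: "card T = card Z" if "maximal_independent_set G T" for T
    using wc that unfolding well_covered_def by blast
  have cardS: "card S \<le> card Z" if S: "independent_set G S" for S
  proof -
    obtain T where T: "maximal_independent_set G T" "S \<subseteq> T"
      using ex_maximal_independent_set_superset[OF \<open>pair_graph G\<close> S] by blast
    have "T \<subseteq> pverts G" using T(1) unfolding maximal_independent_set_def independent_set_def by blast
    then have "finite T" using pair_finite_verts finite_subset by blast
    then show ?thesis using card_mono[of T S] T cardT by simp
  qed
  have "\<exists>m. inj_on m X' \<and> (\<forall>x\<in>X'. m x \<in> N x)"
  proof (rule hall_marriage[OF finX'])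
    have "N x \<subseteq> pverts G" for x using wellformed' unfolding N_def by blast
    then show "finite (N x)" for x using pair_finite_verts finite_subset by blast
    show "card J \<le> card (\<Union>(N ` J))" if J: "J \<subseteq> X'" for J
    proof -
      \<comment> \<open>Replacing the neighbours \<open>?U\<close> by \<open>J\<close> turns
        \<open>Z\<close> into another independent set, which cannot be larger than \<open>Z\<close>;
        hence \<open>card J \<le> card ?U\<close>.\<close>
      let ?U = "\<Union>(N ` J)"
      have UZ: "?U \<subseteq> Z" using NY J X'X YZ by blast
      have JX: "J \<subseteq> X" using J X'X by blast
      have "(u, v) \<notin> parcs G" if "u \<in> J" "v \<in> Z - ?U" for u v
        using that unfolding N_def by blast
      moreover from this have "(v, u) \<notin> parcs G" if "u \<in> J" "v \<in> Z - ?U" for u v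
        using that arcs_symmetric by blast
      ultimately have "\<forall>u\<in>J \<union> (Z - ?U). \<forall>v\<in>J \<union> (Z - ?U). (u, v) \<notin> parcs G"
        using ZE XE JX by blast
      moreover have "J \<union> (Z - ?U) \<subseteq> pverts G" using JX XY(1) unfolding Z_def by blast
      ultimately have "card (J \<union> (Z - ?U)) \<le> card Z"
        by (intro cardS) (simp add: independent_set_def)
      moreover have "card (J \<union> (Z - ?U)) = card J + card (Z - ?U)"
        using J finX' finZ by (intro card_Un_disjoint) (auto simp: Z_def intro: finite_subset)
      moreover have "card (Z - ?U) = card Z - card ?U"
        using UZ finZ by (meson card_Diff_subset finite_subset)
      moreover have "card ?U \<le> card Z" using UZ finZ by (rule card_mono[rotated])
      ultimately show ?thesis by linarith
    qed
  qed
  then obtain m where inj: "inj_on m X'" and m: "\<And>x. x \<in> X' \<Longrightarrow> (x, m x) \<in> parcs G"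
    unfolding N_def by blast
  have mY: "m x \<in> Y" if "x \<in> X'" for x using NY[of x] m that X'X unfolding N_def by blast
  have "N x \<subseteq> N x'" if x: "x \<in> X'" "x' \<in> X'" and e: "(x', m x) \<in> parcs G" for x x'
  proof (rule ccontr)
    \<comment> \<open>A maximal independent set containing \<open>x'\<close> and \<open>y\<close> meets each matching edge at most
      once and misses the edge at \<open>x\<close>, so it is too small.\<close>
    assume "\<not> N x \<subseteq> N x'"
    then obtain y where y: "(x, y) \<in> parcs G" "(x', y) \<notin> parcs G" unfolding N_def by blast
    have "(y, x') \<notin> parcs G" using y arcs_symmetric by blast
    moreover have "x' \<in> pverts G" "y \<in> pverts G" using wellformed' e y by blast+
    moreover have "(v, v) \<notin> parcs G" for v using no_loops' by blast
    ultimately have "independent_set G {x', y}" using y(2) unfolding independent_set_def by blast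
    from ex_maximal_independent_set_superset[OF \<open>pair_graph G\<close> this]
    obtain S where S: "maximal_independent_set G S" "x' \<in> S" "y \<in> S" by blast
    have SE: "(u, v) \<notin> parcs G" if "u \<in> S" "v \<in> S" for u v
      using that S(1) unfolding maximal_independent_set_def independent_set_def by blast
    have SV: "S \<subseteq> pverts G"
      using S(1) unfolding maximal_independent_set_def independent_set_def by blast
    \<comment> \<open>From each matching edge \<open>{z, m z}\<close>, \<open>f\<close> picks an end
      outside \<open>S\<close>. At \<open>x\<close> it picks \<open>x\<close> itself, and
      \<open>m x\<close> is a further vertex outside \<open>S\<close>.\<close>
    define f where "f = (\<lambda>z. if z \<in> S then m z else z)"
    have out: "x \<notin> S" "m x \<notin> S" using SE S y e by blast+
    have XmY: "z \<noteq> m w" if "z \<in> X'" "w \<in> X'" for z w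
      using mY[OF that(2)] that(1) X'X XY(2) by blast
    have "inj_on f X'"
      using inj XmY unfolding f_def inj_on_def by metis
    moreover have "m x \<notin> f ` X'"
    proof
      assume "m x \<in> f ` X'"
      then obtain z where z: "z \<in> X'" "m x = f z" by blast
      then have "z \<in> S" "m x = m z" using XmY[OF z(1) x(1)] unfolding f_def by (auto split: if_splits)
      then have "x = z" using inj x z by (simp add: inj_on_def)
      then show False using out \<open>z \<in> S\<close> by blast
    qed
    ultimately have "card (insert (m x) (f ` X')) = Suc (card X')"
      using finX' by (simp add: card_image)
    moreover have "insert (m x) (f ` X') \<subseteq> pverts G - S"
    proof -
      have "f z \<in> pverts G - S" if "z \<in> X'" for z
        using that SE[of z "m z"] m[OF that] wellformed'[OF m[OF that]] unfolding f_def by auto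
      moreover have "m x \<in> pverts G - S" using out wellformed' e by blast
      ultimately show ?thesis by blast
    qed
    then have "card (insert (m x) (f ` X')) \<le> card (pverts G - S)"
      using pair_finite_verts by (intro card_mono) auto
    \<comment> \<open>The complement of \<open>S\<close> is as large as that of \<open>Z\<close>,
      namely \<open>card X'\<close>: too small for the \<open>card X' + 1\<close> vertices just
      found.\<close>
    moreover have "card (pverts G - S) = card (pverts G) - card Z"
      using SV cardT[OF S(1)] pair_finite_verts by (metis card_Diff_subset finite_subset)
    moreover have "card Z = card (pverts G) - card X'"
      unfolding Z_def using X'X XY(1) finX' by (intro card_Diff_subset) auto
    moreover have "card X' \<le> card (pverts G)"
      using X'X XY(1) pair_finite_verts by (intro card_mono) auto
    ultimately show False by linarith
  qed
  then show ?thesis using inj m unfolding N_def by blast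
qed

section \<open>Induced matchings in a bipartite graph\<close>

text \<open>By \<open>unique\<close>, the only edges between \<open>B\<close> and its image under
  \<open>m\<close> are the pairs \<open>x\<close>, \<open>m x\<close>, and the independent sides
  contribute no others. It also makes \<open>m\<close> injective on \<open>B\<close>, so distinct
  pairs are disjoint.\<close>

lemma induced_matching_bipartite:
  fixes G :: "'a pair_pre_digraph"
  assumes "pair_graph G" and XY: "X \<inter> Y = {}" "independent_set G X" "independent_set G Y"
    and B: "B \<subseteq> X" "m ` B \<subseteq> Y" "\<And>x. x \<in> B \<Longrightarrow> (x, m x) \<in> parcs G"
    and unique: "\<And>x x'. x \<in> B \<Longrightarrow> x' \<in> B \<Longrightarrow> (x, m x') \<in> parcs G \<Longrightarrow> x = x'"
  shows "induced_matching G ((\<lambda>x. {x, m x}) ` B)" (is "induced_matching G ?M")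
    and "card ((\<lambda>x. {x, m x}) ` B) = card B"
proof -
  interpret pair_graph G by fact
  have XE: "(u, v) \<notin> parcs G" if "u \<in> X" "v \<in> X" for u v
    using that XY(2) unfolding independent_set_def by blast
  have YE: "(u, v) \<notin> parcs G" if "u \<in> Y" "v \<in> Y" for u v
    using that XY(3) unfolding independent_set_def by blast
  have eq: "x = x'" if "x \<in> B" "x' \<in> B" "z \<in> {x, m x}" "z \<in> {x', m x'}" for x x' z
  proof -
    have "x \<noteq> m x'" "x' \<noteq> m x" using that B XY(1) by blast+
    then have "x = x' \<or> m x = m x'" using that(3,4) by auto
    then show ?thesis using unique[OF that(1,2)] B(3)[OF that(1)] by auto
  qed
  have "inj_on (\<lambda>x. {x, m x}) B" by (rule inj_onI) (use eq in blast)
  then show "card ?M = card B" by (rule card_image)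
  have MV: "\<Union>?M \<subseteq> pverts G" using B(3) wellformed' by blast
  have arcs: "{(u, v). {u, v} \<in> ?M} = {e \<in> parcs G. fst e \<in> \<Union>?M \<and> snd e \<in> \<Union>?M}" (is "?L = ?R")
  proof (intro equalityI subsetI)
    fix p assume "p \<in> ?L"
    then obtain u v x where "p = (u, v)" "x \<in> B" "{u, v} = {x, m x}" by blast
    then show "p \<in> ?R" using B(3)[of x] arcs_symmetric by (auto simp: doubleton_eq_iff)
  next
    fix p assume "p \<in> ?R"
    then obtain u v x x' where p: "p = (u, v)" "(u, v) \<in> parcs G" "x \<in> B" "x' \<in> B"
      "u \<in> {x, m x}" "v \<in> {x', m x'}"
      by (cases p) auto
    have inX: "x \<in> X" "x' \<in> X" and inY: "m x \<in> Y" "m x' \<in> Y" using B p by blast+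
    have "u \<noteq> x \<or> v \<noteq> x'" using XE[OF inX] p(2) by blast
    moreover have "u \<noteq> m x \<or> v \<noteq> m x'" using YE[OF inY] p(2) by blast
    ultimately consider "u = x" "v = m x'" | "u = m x" "v = x'" using p(5,6) by blast
    then have "{u, v} \<in> ?M"
    proof cases
      case 1
      then have "x = x'" using unique p by blast
      then show ?thesis using 1 p by blast
    next
      case 2
      then have "x' = x" using unique p arcs_symmetric by blast
      then have "{u, v} = {x, m x}" using 2 by blast
      then show ?thesis using p(3) by blast
    qed
    then show "p \<in> ?L" using p(1) by blast
  qed
  have wf: "wf_digraph (with_proj \<lparr>pverts = \<Union>M, parcs = {(u, v). {u, v} \<in> M}\<rparr>)" for M :: "'a set set"
    by unfold_locales auto
  have sub: "{(u, v). {u, v} \<in> ?M} \<subseteq> parcs G" using arcs by blast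
  have "induced_subgraph (with_proj \<lparr>pverts = \<Union>?M, parcs = {(u, v). {u, v} \<in> ?M}\<rparr>) (with_proj G)"
    unfolding induced_subgraph_def subgraph_def compatible_def with_proj_simps pair_pre_digraph.simps
    by (intro conjI MV sub wf_digraph wf arcs refl)
  moreover have "?M \<subseteq> uedges G" unfolding uedges_def using B(3) by blast
  moreover have "pairwise disjnt ?M"
  proof (rule pairwiseI)
    fix e e' assume "e \<in> ?M" "e' \<in> ?M" "e \<noteq> e'"
    then obtain x x' where x: "x \<in> B" "x' \<in> B" "e = {x, m x}" "e' = {x', m x'}" "x \<noteq> x'"
      by blast
    then show "disjnt e e'" using eq[OF x(1,2)] unfolding disjnt_iff by metis
  qed
  ultimately show "induced_matching G ?M" unfolding induced_matching_def by (intro conjI)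
qed

section \<open>Equality of the two invariants\<close>

theorem theorem4p5:
  fixes G :: "'a pair_pre_digraph"
  assumes "pair_graph G" and "well_covered G" and "bipartite G"
  shows "indmatch G = cochord G"
proof (rule antisym)
  interpret pair_graph G by fact
  let ?S = "{card M |M. induced_matching G M}"
  have finS: "finite ?S" by (rule finite_induced_matching_cards) fact
  have "0 \<in> ?S" using induced_matching_empty[OF assms(1)] by (metis (mono_tags) card.empty mem_Collect_eq)
  then have "indmatch G \<in> ?S" unfolding indmatch_def using finS by (intro Max_in) auto
  then obtain M where M: "induced_matching G M" "card M = indmatch G" by auto
  \<comment> \<open>Some finite cover exists, so the \<open>LEAST\<close> in \<open>cochord\<close>
    is attained.\<close>
  have "\<exists>k C. finite C \<and> card C = k \<and> co_chordal_cover G C"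
    using co_chordal_cover_exists[OF assms(1)] by blast
  then have "\<exists>C. finite C \<and> card C = cochord G \<and> co_chordal_cover G C"
    unfolding cochord_def by (rule LeastI_ex)
  then obtain C where C: "finite C" "card C = cochord G" "co_chordal_cover G C" by blast
  show "indmatch G \<le> cochord G"
    using card_induced_matching_le_cover[OF M(1) C(3,1)] M(2) C(2) by simp

  obtain X Y where XY: "X \<union> Y = pverts G" "X \<inter> Y = {}" "independent_set G X" "independent_set G Y"
    using assms(3) unfolding bipartite_def by blast
  define X' where "X' = {x \<in> X. \<exists>y. (x, y) \<in> parcs G}"
  define N where "N = (\<lambda>x. parcs G `` {x})"
  have X'X: "X' \<subseteq> X" unfolding X'_def by blast
  have XE: "(u, v) \<notin> parcs G" if "u \<in> X" "v \<in> X" for u v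
    using that XY(3) unfolding independent_set_def by blast
  have YE: "(u, v) \<notin> parcs G" if "u \<in> Y" "v \<in> Y" for u v
    using that XY(4) unfolding independent_set_def by blast
  have finX': "finite X'" using finite_subset[OF _ pair_finite_verts, of X'] XY(1) X'X by blast
  from well_covered_bipartite_matching[OF assms(1,2) XY] obtain m where
    m: "\<And>x. x \<in> X' \<Longrightarrow> (x, m x) \<in> parcs G"
      "\<And>x x'. x \<in> X' \<Longrightarrow> x' \<in> X' \<Longrightarrow> (x', m x) \<in> parcs G \<Longrightarrow> N x \<subseteq> N x'"
    unfolding X'_def[symmetric] N_def by blast
  \<comment> \<open>Inclusion of neighbourhoods is only a preorder on \<open>X'\<close>, since
    distinct vertices may have equal neighbourhoods.\<close>
  have "\<exists>B (f :: 'a \<Rightarrow> nat). B \<subseteq> X' \<and> (\<forall>x\<in>B. \<forall>y\<in>B. x \<noteq> y \<longrightarrow> \<not> N x \<subseteq> N y) \<and>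
    f ` X' \<subseteq> {..<card B} \<and> (\<forall>x\<in>X'. \<forall>y\<in>X'. f x = f y \<longrightarrow> N x \<subseteq> N y \<or> N y \<subseteq> N x)"
    by (rule dilworth[OF finX']) auto
  then obtain B and f :: "'a \<Rightarrow> nat" where B: "B \<subseteq> X'"
    and antichain: "\<forall>x\<in>B. \<forall>y\<in>B. x \<noteq> y \<longrightarrow> \<not> N x \<subseteq> N y"
    and f: "f ` X' \<subseteq> {..<card B}"
    and chains: "\<forall>x\<in>X'. \<forall>y\<in>X'. f x = f y \<longrightarrow> N x \<subseteq> N y \<or> N y \<subseteq> N x"
    by (elim exE conjE)
  have mY: "m x \<in> Y" if "x \<in> X'" for x
    using m(1)[OF that] XE[of x "m x"] that X'X wellformed'[OF m(1)[OF that]] XY(1) by blast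
  have BX: "B \<subseteq> X" "m ` B \<subseteq> Y" using B X'X mY by blast+
  have edge: "(x, m x) \<in> parcs G" if "x \<in> B" for x using B that m(1) by blast
  \<comment> \<open>An edge from \<open>x\<close> to \<open>m x'\<close> forces
    \<open>N x' \<subseteq> N x\<close>, which the antichain allows only for equal vertices.\<close>
  have unique: "x = x'" if "x \<in> B" "x' \<in> B" "(x, m x') \<in> parcs G" for x x'
  proof -
    have "N x' \<subseteq> N x" using that B by (intro m(2)) auto
    then show ?thesis using antichain that by metis
  qed
  note match = induced_matching_bipartite[OF assms(1) XY(2-4) BX edge unique]
  have "card B \<in> ?S"
    using match by (metis (mono_tags, lifting) mem_Collect_eq)
  then have Bind: "card B \<le> indmatch G" unfolding indmatch_def using finS by (rule Max_ge[rotated])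

  \<comment> \<open>\<open>H i\<close> is the spanning subgraph of all edges at the chain with label
    \<open>i\<close>; the two disjuncts keep its arc set symmetric.\<close>
  define H where "H = (\<lambda>i. \<lparr>pverts = pverts G,
    parcs = {(u, v) \<in> parcs G. (u \<in> X' \<and> f u = i) \<or> (v \<in> X' \<and> f v = i)}\<rparr>)"
  have Hsub: "parcs (H i) \<subseteq> parcs G" and HV: "pverts (H i) = pverts G" for i
    unfolding H_def by auto
  have Hpg: "pair_graph (H i)" for i
  proof -
    have "sym (parcs (H i))" unfolding H_def using arcs_symmetric by (auto intro!: symI)
    moreover have "finite (parcs (H i))" using Hsub pair_finite_arcs finite_subset by blast
    moreover have "fst e \<in> pverts (H i)" "snd e \<in> pverts (H i)" "fst e \<noteq> snd e" if "e \<in> parcs (H i)" for e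
      using that Hsub[of i] HV[of i] arc_fst_in_verts arc_snd_in_verts pair_no_loops by auto
    ultimately show ?thesis
      using HV pair_finite_verts by unfold_locales (auto simp: symmetric_def)
  qed
  have "pair_graph (H i) \<and> subgraph (with_proj (H i)) (with_proj G) \<and> co_chordal (H i)" for i
  proof (intro conjI Hpg)
    interpret Hi: pair_graph "H i" by (rule Hpg)
    show "subgraph (with_proj (H i)) (with_proj G)"
      unfolding subgraph_def compatible_def using Hsub HV wf_digraph Hi.wf_digraph by simp
    show "co_chordal (H i)"
    proof (rule co_chordal_bipartite_nested[OF Hpg])
      show "X \<union> Y = pverts (H i)" using XY(1) HV by simp
      show "independent_set (H i) X" "independent_set (H i) Y"
        using XY(3,4) Hsub HV unfolding independent_set_def by blast+
      have inX: "a \<in> X' \<and> f a = i \<and> b \<in> N a" if "a \<in> X" "(a, b) \<in> parcs (H i)" for a b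
        using that XE[of a b] X'X unfolding H_def N_def by auto
      have inH: "(a, b) \<in> parcs (H i)" if "a \<in> X'" "f a = i" "b \<in> N a" for a b
        using that unfolding H_def N_def by auto
      fix a b a' b'
      assume "a \<in> X" "a' \<in> X" "(a, b) \<in> parcs (H i)" "(a', b') \<in> parcs (H i)"
      then have a: "a \<in> X'" "f a = i" "b \<in> N a" and a': "a' \<in> X'" "f a' = i" "b' \<in> N a'"
        using inX by blast+
      then have "N a \<subseteq> N a' \<or> N a' \<subseteq> N a" using chains by simp
      then show "(a, b') \<in> parcs (H i) \<or> (a', b) \<in> parcs (H i)"
        using inH a a' by blast
    qed
  qed
  moreover have "(\<Union>K\<in>H ` {..<card B}. uedges K) = uedges G"
  proof
    show "(\<Union>K\<in>H ` {..<card B}. uedges K) \<subseteq> uedges G"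
      using Hsub unfolding uedges_def by blast
    show "uedges G \<subseteq> (\<Union>K\<in>H ` {..<card B}. uedges K)"
    proof
      fix e assume "e \<in> uedges G"
      then obtain u v where e: "e = {u, v}" "(u, v) \<in> parcs G" unfolding uedges_def by blast
      \<comment> \<open>\<open>Y\<close> is independent, so every edge has an end in
        \<open>X\<close>, and that end is not isolated.\<close>
      have "u \<in> X' \<or> v \<in> X'"
        using e(2) arcs_symmetric[OF e(2)] wellformed'[OF e(2)] XY(1) YE[of u v] unfolding X'_def by blast
      then obtain i where i: "i < card B" "(u, v) \<in> parcs (H i)"
        using f e(2) unfolding H_def by auto
      then show "e \<in> (\<Union>K\<in>H ` {..<card B}. uedges K)" using e(1) unfolding uedges_def by blast
    qed
  qed
  ultimately have "co_chordal_cover G (H ` {..<card B})" unfolding co_chordal_cover_def by blast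
  then have "cochord G \<le> card (H ` {..<card B})"
    unfolding cochord_def by (intro Least_le) blast
  also have "\<dots> \<le> card B" using card_image_le[of "{..<card B}" H] by simp
  also note Bind
  finally show "cochord G \<le> indmatch G" .
qed

end
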